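(* Let $q$ be an odd prime power, $\mathbb{A}=\mathbb{F}_q[X]$, $f\in\mathbb{A}$ with $\deg f\ge1$, and let $S\subseteq\mathbb{F}_q^*$ be any set with $|S|=(q-1)/2$ such that $\alpha\in S$ implies $-\alpha\notin S$. If $f$ has only one prime divisor $P$, and either $q\equiv 1\pmod 4$ or $P$ has even degree, then $\mathrm{ord}_f G(f,S)=4$. Otherwise, $\mathrm{ord}_f G(f,S)\in\{1,2\}$.
   Context: For non-zero $g\in\mathbb{A}$, $\mathrm{sgn}(g)$ is the leading coefficient of $g$. $G(f,S)=\prod g$, the product over all non-zero $g\in\mathbb{A}$ with $\mathrm{sgn}(g)\in S$, $0\le\deg g<\deg f$, $\gcd(g,f)=1$. $\mathrm{ord}_f$ denotes multiplicative order modulo $f$. A prime divisor is a monic irreducible divisor. *)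

theory Defs
  imports
    "HOL-Library.Cardinality"
    "HOL-Computational_Algebra.Computational_Algebra"
    "HOL-Number_Theory.Number_Theory"
begin

definition prime_divisors :: "'a::field poly \<Rightarrow> 'a poly set"
  where "prime_divisors f = {P. lead_coeff P = 1 \<and> irreducible P \<and> P dvd f}"

(* The library's \<open>ord\<close> is restricted to the natural numbers; the convention here is the same:
   the value is 0 if no positive power is congruent to 1. *)
definition poly_ord :: "'a::field poly \<Rightarrow> 'a poly \<Rightarrow> nat"
  where "poly_ord f g =
    (if \<exists>d>0. [g ^ d = 1] (mod f) then (LEAST d. d > 0 \<and> [g ^ d = 1] (mod f)) else 0)"

(* The condition \<open>g \<noteq> 0\<close> is needed because the library sets \<open>degree 0 = 0\<close>. *)
definition G_index :: "'a::field poly \<Rightarrow> 'a set \<Rightarrow> 'a poly set"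
  where "G_index f S =
    {g. g \<noteq> 0 \<and> lead_coeff g \<in> S \<and> degree g < degree f \<and> coprime g f}"

definition G :: "'a::field poly \<Rightarrow> 'a set \<Rightarrow> 'a poly"
  where "G f S = (\<Prod>g\<in>G_index f S. g)"

(* The product defining \<open>G\<close> is over a finite set, hence is not the junk value 1. *)
lemma finite_G_index: "finite (G_index f S)" for f :: "'a::{field,finite} poly"
proof (rule finite_subset)
  show "G_index f S \<subseteq> Poly ` {xs. set xs \<subseteq> UNIV \<and> length xs \<le> degree f}"
  proof
    fix g assume "g \<in> G_index f S"
    then have "g \<noteq> 0" "degree g < degree f"
      by (auto simp: G_index_def)
    then have "length (coeffs g) \<le> degree f"
      by (simp add: length_coeffs_degree)
    moreover have "g = Poly (coeffs g)"
      by simp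
    ultimately show "g \<in> Poly ` {xs. set xs \<subseteq> UNIV \<and> length xs \<le> degree f}"
      by blast
  qed
  show "finite (Poly ` {xs. set xs \<subseteq> (UNIV :: 'a set) \<and> length xs \<le> degree f})"
    by (intro finite_imageI finite_lists_length_le) simp
qed

end

theory Submission
  imports Defs
begin

text \<open>
  Let \<open>U\<close> be the reduced residues coprime to \<open>f\<close>, \<open>H\<close> those with leading coefficient in \<open>S\<close> and
  \<open>T = {u \<in> U. u\<^sup>2 \<equiv> 1}\<close>. Since \<open>U\<close> is the disjoint union of \<open>H\<close> and \<open>- H\<close>, the product over
  \<open>U - T\<close> is \<open>(- 1) ^ card (H - T)\<close> times the square of the product over \<open>H - T\<close>; pairing inverses
  shows that it is \<open>1\<close>. The elements of \<open>T\<close> square to \<open>1\<close>, whence \<open>(G f S)\<^sup>2 \<equiv> (- 1) ^ card (H - T)\<close>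
  and only the parity of \<open>card (H - T)\<close> matters.

  If \<open>f = a b\<close> with coprime nonunits \<open>a\<close>, \<open>b\<close>, take \<open>e \<equiv> 1\<close> modulo \<open>a\<close> and \<open>e \<equiv> - 1\<close> modulo \<open>b\<close>:
  sending \<open>u\<close> to whichever of \<open>\<plusminus> e u\<close> lies in \<open>H\<close> is a fixed-point-free involution of \<open>H - T\<close>. If
  \<open>P\<close> is the only prime divisor, then \<open>T = {1, - 1}\<close>, so \<open>card (H - T) = card H - 1\<close>, and with
  \<open>n = deg f\<close>, \<open>d = deg P\<close> one has \<open>2 card H = q\<^bsup>n - d\<^esup> (q\<^bsup>d\<^esup> - 1)\<close>.
\<close>

section \<open>Pairing arguments\<close>

text \<open>Each pair \<open>{a, i a}\<close> contributes two elements and a factor congruent to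
  \<open>1\<close>; removing one pair gives an induction on the cardinality.\<close>

lemma involution_cong_prod:
  fixes g :: "'b \<Rightarrow> 'c::unique_euclidean_semiring"
  assumes "finite A"
    and "\<And>a. a \<in> A \<Longrightarrow> i a \<in> A \<and> i a \<noteq> a \<and> i (i a) = a \<and> [g a * g (i a) = 1] (mod m)"
  shows "even (card A) \<and> [prod g A = 1] (mod m)"
  using assms
proof (induction "card A" arbitrary: A rule: less_induct)
  case less
  show ?case
  proof (cases "A = {}")
    case False
    then obtain a where a: "a \<in> A" by blast
    note i = less.prems(2)[OF a]
    let ?B = "A - {a, i a}"
    have cA: "card A = card ?B + 2" "prod g A = g a * g (i a) * prod g ?B"
    proof -
      have "A = insert a (insert (i a) ?B)" using a i by blast
      moreover have "card (insert a (insert (i a) ?B)) = card ?B + 2"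
        "prod g (insert a (insert (i a) ?B)) = g a * g (i a) * prod g ?B"
        using i less.prems(1) by (auto simp: mult.assoc)
      ultimately show "card A = card ?B + 2" "prod g A = g a * g (i a) * prod g ?B" by simp_all
    qed
    have "even (card ?B) \<and> [prod g ?B = 1] (mod m)"
    proof (rule less.hyps)
      show "card ?B < card A" using cA by simp
      show "finite ?B" using less.prems(1) by simp
      fix b assume b: "b \<in> ?B"
      then have "i b \<noteq> a" "i b \<noteq> i a" using less.prems(2)[of b] i by auto
      then show "i b \<in> ?B \<and> i b \<noteq> b \<and> i (i b) = b \<and> [g b * g (i b) = 1] (mod m)"
        using less.prems(2)[of b] b by auto
    qed
    moreover from this have "[g a * g (i a) * prod g ?B = 1 * 1] (mod m)"
      using i by (intro cong_mult) auto
    ultimately show ?thesis using cA by simp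
  qed simp
qed

lemma involution_even_card:
  assumes "finite A" "\<And>a. a \<in> A \<Longrightarrow> i a \<in> A \<and> i a \<noteq> a \<and> i (i a) = a"
  shows "even (card A)"
  \<comment> \<open>With \<open>g\<close> constantly \<open>1\<close> the condition on products is
    trivial, which leaves the parity claim.\<close>
  using involution_cong_prod[where g = "\<lambda>_. 1::nat" and i = i and A = A and m = 0] assms by simp

section \<open>Coprimality and factorization of polynomials over a field\<close>

lemma coprime_poly_bezout:
  fixes a b :: "'a::field poly"
  assumes "coprime a b"
  shows "\<exists>x y. x * a + y * b = 1"
  using assms
\<comment> \<open>Euclid's algorithm. Since \<open>degree 0 = 0\<close>, the shift by
  \<open>Suc\<close> is what makes the measure drop when a nonzero constant \<open>b\<close> leaves
  remainder \<open>0\<close>.\<close>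
proof (induction "if b = 0 then 0 else Suc (degree b)" arbitrary: a b rule: less_induct)
  case less
  show ?case
  proof (cases "b = 0")
    case True
    then have "a dvd 1" using less.prems by simp
    then obtain x where "1 = a * x" by (elim dvdE)
    then have "x * a + 0 * b = 1" by (simp add: mult.commute)
    then show ?thesis by blast
  next
    case False
    have "coprime b (a mod b)"
      using less.prems by (simp add: coprime_def) (metis dvd_mod_imp_dvd)
    moreover have "(if a mod b = 0 then 0 else Suc (degree (a mod b))) < (if b = 0 then 0 else Suc (degree b))"
      using False degree_mod_less'[of b a] by auto
    ultimately obtain x y where "x * b + y * (a mod b) = 1" using less.hyps by blast
    moreover have "a mod b = a - a div b * b" by (simp add: minus_div_mult_eq_mod)
    ultimately have "y * a + (x - y * (a div b)) * b = 1" by (simp add: algebra_simps)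
    then show ?thesis by blast
  qed
qed

text \<open>Bezout in the form used below: with invertibility modulo \<open>f\<close>, closure of
  coprimality under products and under reduction modulo \<open>f\<close> becomes a computation with
  congruences.\<close>

lemma coprime_poly_iff_invertible:
  fixes g f :: "'a::field poly"
  shows "coprime g f \<longleftrightarrow> (\<exists>h. [g * h = 1] (mod f))"
proof
  assume "coprime g f"
  then obtain x y where "x * g + y * f = 1" using coprime_poly_bezout by blast
  then have "g * x - 1 = f * (- y)" by (simp add: algebra_simps)
  then show "\<exists>h. [g * h = 1] (mod f)" unfolding cong_iff_dvd_diff by (metis dvd_triv_left)
next
  assume "\<exists>h. [g * h = 1] (mod f)"
  then obtain h where h: "f dvd g * h - 1" unfolding cong_iff_dvd_diff by blast
  show "coprime g f"
  proof (rule coprimeI)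
    fix c assume "c dvd g" "c dvd f"
    then have "c dvd g * h - 1" "c dvd g * h" using h dvd_trans by auto
    then show "is_unit c" by (metis dvd_diff_right_iff)
  qed
qed

lemma coprime_poly_mult_left:
  fixes a b f :: "'a::field poly"
  assumes "coprime a f" "coprime b f"
  shows "coprime (a * b) f"
proof -
  obtain x y where "[a * x = 1] (mod f)" "[b * y = 1] (mod f)"
    using assms unfolding coprime_poly_iff_invertible by blast
  then have "[(a * x) * (b * y) = 1 * 1] (mod f)" by (rule cong_mult)
  then have "[(a * b) * (x * y) = 1] (mod f)" by (simp add: mult_ac)
  then show ?thesis unfolding coprime_poly_iff_invertible by blast
qed

lemma coprime_poly_power_left:
  fixes a f :: "'a::field poly"
  assumes "coprime a f"
  shows "coprime (a ^ k) f"
  by (induction k) (use assms coprime_poly_mult_left in auto)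

lemma coprime_poly_dvd_mult:
  fixes a b c :: "'a::field poly"
  assumes "coprime a b" "a dvd b * c"
  shows "a dvd c"
proof -
  obtain x y where "x * a + y * b = 1" using assms coprime_poly_bezout by blast
  then have "c = (x * a + y * b) * c" by simp
  also have "\<dots> = (x * c) * a + y * (b * c)" by (simp add: algebra_simps)
  also have "a dvd \<dots>" using assms by simp
  finally show ?thesis .
qed

text \<open>Dividing by the nonunit \<open>P\<close> lowers the degree, so repeated division
  stops.\<close>

lemma poly_extract_power:
  fixes f P :: "'a::field poly"
  assumes "f \<noteq> 0" "\<not> is_unit P"
  shows "\<exists>k b. f = P ^ k * b \<and> \<not> P dvd b"
  using assms(1)
proof (induction "degree f" arbitrary: f rule: less_induct)
  case less
  show ?case
  proof (cases "P dvd f")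
    case True
    then obtain h where h: "f = P * h" by blast
    then have "P \<noteq> 0" "h \<noteq> 0" using less.prems by auto
    moreover from this have "degree P \<noteq> 0" using assms(2) is_unit_iff_degree by blast
    ultimately have "degree h < degree f" using h by (simp add: degree_mult_eq)
    then obtain k b where "h = P ^ k * b" "\<not> P dvd b" using less.hyps \<open>h \<noteq> 0\<close> by blast
    then have "f = P ^ Suc k * b" using h by (simp add: mult.assoc)
    then show ?thesis using \<open>\<not> P dvd b\<close> by blast
  next
    case False
    then show ?thesis by (intro exI[of _ 0] exI[of _ f]) simp
  qed
qed

text \<open>A nonunit divisor of minimal degree is irreducible, since a proper factor of it would be
  a nonunit divisor of smaller degree.\<close>

lemma prime_divisors_nonempty:
  fixes f :: "'a::field poly"
  assumes "f \<noteq> 0" "\<not> is_unit f"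
  shows "prime_divisors f \<noteq> {}"
proof -
  obtain p where p: "p dvd f" "\<not> is_unit p"
    and min: "\<And>r. r dvd f \<Longrightarrow> \<not> is_unit r \<Longrightarrow> degree p \<le> degree r"
    using assms arg_min_nat_lemma[of "\<lambda>r. r dvd f \<and> \<not> is_unit r" f degree] by auto
  have p0: "p \<noteq> 0" using p assms by auto
  have "irreducible p"
  proof (rule irreducibleI)
    fix a b assume ab: "p = a * b"
    show "is_unit a \<or> is_unit b"
    proof (rule ccontr)
      assume *: "\<not> (is_unit a \<or> is_unit b)"
      then have "degree p \<le> degree a" using min[of a] p ab by (meson dvd_mult_left)
      moreover have "a \<noteq> 0" "b \<noteq> 0" using ab p0 by auto
      moreover from this have "degree b \<noteq> 0" using * is_unit_iff_degree by blast
      ultimately show False using ab by (simp add: degree_mult_eq)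
    qed
  qed (use p0 p in auto)
  \<comment> \<open>Scaling by \<open>c\<close> makes \<open>p\<close> monic, as membership in
    \<open>prime_divisors\<close> demands.\<close>
  define c where "c = [:inverse (lead_coeff p):]"
  have c: "is_unit c" using p0 by (simp add: c_def is_unit_pCons_iff)
  have "c * p dvd f" "irreducible (c * p)"
    using c p \<open>irreducible p\<close> by (simp_all add: mult_unit_dvd_iff' irreducible_mult_unit_left)
  moreover have "lead_coeff (c * p) = 1" using p0 by (simp add: c_def)
  ultimately show ?thesis unfolding prime_divisors_def by blast
qed

lemma irreducible_poly_coprime:
  fixes P b :: "'a::field poly"
  assumes "irreducible P" "\<not> P dvd b"
  shows "coprime P b"
proof (rule coprimeI)
  fix c assume c: "c dvd P" "c dvd b"
  then obtain d where d: "P = c * d" by blast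
  have "\<not> is_unit d"
  proof
    assume "is_unit d"
    then have "P dvd c" using d by simp
    then show False using c(2) assms(2) dvd_trans by blast
  qed
  then show "is_unit c" using irreducibleD[OF assms(1) d] by blast
qed

lemma prime_divisors_eqI:
  fixes P Q f :: "'a::field poly"
  assumes "P \<in> prime_divisors f" "Q \<in> prime_divisors f" "P dvd Q"
  shows "P = Q"
proof -
  obtain c where c: "Q = P * c" using assms(3) by blast
  then have "is_unit c" using assms irreducibleD[of Q P c] by (auto simp: prime_divisors_def irreducible_def)
  moreover have "lead_coeff c = 1" using c assms by (simp add: prime_divisors_def lead_coeff_mult)
  ultimately have "c = 1" by (metis is_unit_monom_trivial monom_eq_1_iff)
  then show ?thesis using c by simp
qed

text \<open>Split off the full power of \<open>P\<close>. A nonunit cofactor would have a prime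
  divisor of its own; this could only be \<open>P\<close>, which no longer divides it.\<close>

lemma single_prime_divisor_power:
  fixes f P :: "'a::field poly"
  assumes "f \<noteq> 0" "prime_divisors f = {P}"
  shows "\<exists>k b. f = P ^ k * b \<and> is_unit b"
proof -
  have P: "irreducible P" using assms by (auto simp: prime_divisors_def)
  then obtain k b where kb: "f = P ^ k * b" "\<not> P dvd b"
    using poly_extract_power[OF assms(1)] irreducible_not_unit by blast
  have "is_unit b"
  proof (rule ccontr)
    assume "\<not> is_unit b"
    then obtain Q where "Q \<in> prime_divisors b"
      using prime_divisors_nonempty[of b] kb assms(1) by auto
    moreover from this have "Q \<in> prime_divisors f" using kb by (simp add: prime_divisors_def)
    ultimately have "Q = P" using assms(2) by blast
    then show False using \<open>Q \<in> prime_divisors b\<close> kb(2) by (simp add: prime_divisors_def)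
  qed
  then show ?thesis using kb by blast
qed

text \<open>Here \<open>a\<close> is the full power of \<open>P\<close> in \<open>f\<close>; the
  cofactor \<open>b\<close> is a nonunit because \<open>Q\<close>, being coprime to
  \<open>a\<close>, still divides it.\<close>

lemma two_prime_divisors_split:
  fixes f P Q :: "'a::field poly"
  assumes "f \<noteq> 0" "P \<in> prime_divisors f" "Q \<in> prime_divisors f" "P \<noteq> Q"
  shows "\<exists>a b. f = a * b \<and> coprime a b \<and> \<not> is_unit a \<and> \<not> is_unit b"
proof -
  have P: "irreducible P" "P dvd f" and Q: "irreducible Q" "Q dvd f"
    using assms by (auto simp: prime_divisors_def)
  obtain k b where kb: "f = P ^ k * b" "\<not> P dvd b"
    using poly_extract_power[OF assms(1)] P irreducible_not_unit by blast
  have "\<not> Q dvd P" using prime_divisors_eqI assms by blast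
  then have "coprime (P ^ k) Q"
    using irreducible_poly_coprime[OF Q(1)] coprime_commute coprime_poly_power_left by blast
  then have "Q dvd b" using coprime_poly_dvd_mult[of Q "P ^ k" b] Q kb coprime_commute by blast
  then have "\<not> is_unit b" using Q irreducible_not_unit dvd_trans by blast
  moreover have "k \<noteq> 0" using kb P by (cases k) auto
  then have "\<not> is_unit (P ^ k)" using P irreducible_not_unit by (simp add: is_unit_power_iff)
  moreover have "coprime (P ^ k) b"
    using irreducible_poly_coprime P kb coprime_poly_power_left by blast
  ultimately show ?thesis using kb by blast
qed

lemma reduced_cong_imp_eq:
  fixes g h f :: "'a::field poly"
  assumes "degree g < degree f" "degree h < degree f" "[g = h] (mod f)"
  shows "g = h"
  using assms by (simp add: cong_def mod_poly_less)

text \<open>Induction by splitting off the constant coefficient. Listing \<open>g = 0\<close>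
  separately keeps the zero polynomial in the count for \<open>n = 0\<close>.\<close>

lemma card_polys_degree_less:
  "card {g :: 'a::{field,finite} poly. g = 0 \<or> degree g < n} = CARD('a) ^ n"
    (is "card (?R n) = _")
proof (induction n)
  case 0
  have "?R 0 = {0}" by auto
  then show ?case by simp
next
  case (Suc n)
  have "?R (Suc n) = (\<lambda>(a, p). pCons a p) ` (UNIV \<times> ?R n)"
  proof (intro equalityI subsetI)
    fix g assume "g \<in> ?R (Suc n)"
    then show "g \<in> (\<lambda>(a, p). pCons a p) ` (UNIV \<times> ?R n)"
      by (cases g) (auto simp: image_iff split: if_splits)
  qed (auto split: if_splits)
  moreover have "inj_on (\<lambda>(a, p). pCons a p) ((UNIV :: 'a set) \<times> ?R n)"
    by (auto intro!: inj_onI)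
  ultimately show ?case using Suc by (simp add: card_image card_cartesian_product)
qed

section \<open>Half systems of reduced residues\<close>

text \<open>The assumption \<open>half\<close> replaces the cardinality of \<open>S\<close>: exactly
  one of each pair \<alpha>, -\<alpha> of nonzero constants lies in \<open>S\<close>, and
  \<open>0\<close> does not.\<close>

locale half_system =
  fixes f :: "'a::{field,finite} poly" and S :: "'a set"
  assumes odd_char: "(2::'a) \<noteq> 0"
    and deg: "degree f \<ge> 1"
    and half: "\<alpha> \<in> S \<longleftrightarrow> \<alpha> \<noteq> 0 \<and> - \<alpha> \<notin> S"
begin

definition U where "U = G_index f (UNIV - {0})"

definition H where "H = G_index f S"

definition T where "T = {u \<in> U. [u * u = 1] (mod f)}"

lemma finite_U [simp]: "finite U" and finite_H [simp]: "finite H" and finite_T [simp]: "finite T"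
  using finite_subset[of T U] by (auto simp: U_def H_def T_def finite_G_index)

lemma f_nonzero: "f \<noteq> 0" and f_nonunit: "\<not> is_unit f"
proof -
  show "f \<noteq> 0" using deg by auto
  then show "\<not> is_unit f" using deg by (simp add: is_unit_iff_degree)
qed

text \<open>The polynomial \<open>0\<close> drops out by itself, as it is not coprime to the nonunit
  \<open>f\<close>.\<close>

lemma U_iff: "g \<in> U \<longleftrightarrow> degree g < degree f \<and> coprime g f"
  using f_nonunit by (auto simp: U_def G_index_def)

lemma H_iff: "g \<in> H \<longleftrightarrow> g \<in> U \<and> lead_coeff g \<in> S"
  using half[of 0] by (auto simp: U_def H_def G_index_def)

lemma uminus_U: "- g \<in> U \<longleftrightarrow> g \<in> U"
  by (simp add: U_iff coprime_def)

lemma uminus_H: "- g \<in> H \<longleftrightarrow> g \<in> U \<and> g \<notin> H"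
proof -
  have "g \<in> U \<Longrightarrow> lead_coeff g \<noteq> 0" by (auto simp: U_def G_index_def)
  then show ?thesis using half[of "lead_coeff g"] by (auto simp: H_iff uminus_U)
qed

lemma uminus_T: "- g \<in> T \<longleftrightarrow> g \<in> T"
  by (simp add: T_def uminus_U)

lemma H_subset_U: "H \<subseteq> U" by (auto simp: H_iff)

lemma U_eqI: "u \<in> U \<Longrightarrow> v \<in> U \<Longrightarrow> [u = v] (mod f) \<Longrightarrow> u = v"
  by (rule reduced_cong_imp_eq[of u f v]) (simp_all add: U_iff)

text \<open>\<open>H\<close> represents the units modulo \<open>f\<close> up to sign, so congruence
  up to sign already forces equality.\<close>

lemma H_eqI:
  assumes "u \<in> H" "v \<in> H" "[u = v] (mod f) \<or> [u = - v] (mod f)"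
  shows "u = v"
  using assms(3)
proof
  assume "[u = - v] (mod f)"
  then have "u = - v" using assms H_subset_U by (intro U_eqI) (auto simp: uminus_U)
  then show ?thesis using assms uminus_H[of v] by auto
qed (use assms H_subset_U U_eqI in blast)

text \<open>\<open>A\<close> is the disjoint union of \<open>A \<inter> H\<close> and its negatives,
  and each negated factor contributes one sign. The product is needed for \<open>U - T\<close>, the
  cardinality for \<open>U\<close>.\<close>

lemma symmetric_split:
  assumes "A \<subseteq> U" "\<And>g. g \<in> A \<Longrightarrow> - g \<in> A"
  shows "card A = 2 * card (A \<inter> H)"
    and "\<Prod>A = (- 1) ^ card (A \<inter> H) * (\<Prod>(A \<inter> H))\<^sup>2"
proof -
  have A: "A = (A \<inter> H) \<union> uminus ` (A \<inter> H)"
  proof (intro equalityI subsetI)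
    fix g assume g: "g \<in> A"
    show "g \<in> (A \<inter> H) \<union> uminus ` (A \<inter> H)"
    proof (cases "g \<in> H")
      case False
      then have "- g \<in> A \<inter> H" using g assms uminus_H by blast
      then show ?thesis by (intro UnI2 image_eqI[of _ _ "- g"]) simp_all
    qed (use g in blast)
  qed (use assms(2) in blast)
  have disj: "(A \<inter> H) \<inter> uminus ` (A \<inter> H) = {}"
    by (auto simp: uminus_H)
  have inj: "inj_on uminus (A \<inter> H)" by (simp add: inj_on_def)
  have fin: "finite (A \<inter> H)" by simp
  have "card A = card ((A \<inter> H) \<union> uminus ` (A \<inter> H))"
    using A by (rule arg_cong)
  also have "\<dots> = card (A \<inter> H) + card (uminus ` (A \<inter> H))"
    using fin disj by (intro card_Un_disjoint) auto
  finally show "card A = 2 * card (A \<inter> H)" using inj by (simp add: card_image)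
  have "\<Prod>A = \<Prod>((A \<inter> H) \<union> uminus ` (A \<inter> H))"
    using A by (rule arg_cong)
  also have "\<dots> = \<Prod>(A \<inter> H) * \<Prod>(uminus ` (A \<inter> H))"
    using fin disj by (intro prod.union_disjoint) auto
  also have "\<Prod>(uminus ` (A \<inter> H)) = (\<Prod>g\<in>A \<inter> H. - g)"
    using inj by (simp add: prod.reindex)
  also have "\<dots> = (- 1) ^ card (A \<inter> H) * \<Prod>(A \<inter> H)"
    by (simp add: prod_uminus)
  finally show "\<Prod>A = (- 1) ^ card (A \<inter> H) * (\<Prod>(A \<inter> H))\<^sup>2"
    by (simp add: power2_eq_square mult_ac)
qed

section \<open>Inverses modulo \<open>f\<close> and the square of the half product\<close>

lemma mod_in_U: "coprime g f \<Longrightarrow> g mod f \<in> U"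
proof -
  assume "coprime g f"
  then obtain h where h: "[g * h = 1] (mod f)" using coprime_poly_iff_invertible by blast
  have "[g mod f * h = g * h] (mod f)" by (simp add: cong_def mod_mult_left_eq)
  then have "coprime (g mod f) f" using h cong_trans coprime_poly_iff_invertible by blast
  then show ?thesis using degree_mod_less'[of f g] f_nonzero deg by (cases "g mod f = 0") (auto simp: U_iff)
qed

lemma inverse_ex1:
  assumes "u \<in> U"
  shows "\<exists>!h. h \<in> U \<and> [u * h = 1] (mod f)"
proof -
  have "coprime u f" using assms by (simp add: U_iff)
  then obtain h where h: "[u * h = 1] (mod f)" using coprime_poly_iff_invertible by blast
  have "[h * u = 1] (mod f)" using h by (simp add: mult.commute)
  then have "h mod f \<in> U" using mod_in_U coprime_poly_iff_invertible by blast
  moreover have "[u * (h mod f) = u * h] (mod f)" by (simp add: cong_def mod_mult_right_eq)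
  ultimately have "h mod f \<in> U \<and> [u * (h mod f) = 1] (mod f)" using h cong_trans by blast
  moreover have "x = y" if "x \<in> U \<and> [u * x = 1] (mod f)" "y \<in> U \<and> [u * y = 1] (mod f)" for x y
  proof (rule U_eqI)
    \<comment> \<open>The product \<open>u * x * y\<close> is congruent both to \<open>x\<close> and
      to \<open>y\<close>.\<close>
    have "[(u * y) * x = 1 * x] (mod f)" "[(u * x) * y = 1 * y] (mod f)"
      using that by (blast intro: cong_mult cong_refl)+
    then have "[(u * y) * x = x] (mod f)" "[(u * y) * x = y] (mod f)" by (simp_all add: mult_ac)
    then show "[x = y] (mod f)" using cong_sym cong_trans by blast
  qed (use that in auto)
  ultimately show ?thesis by blast
qed

text \<open>Wilson's argument: away from \<open>T\<close> the units cancel against their inverses.\<close>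
lemma prod_non_involutions: "[\<Prod>(U - T) = 1] (mod f)"
proof -
  define i where "i u = (THE h. h \<in> U \<and> [u * h = 1] (mod f))" for u
  have i: "i u \<in> U" "[u * i u = 1] (mod f)" if "u \<in> U" for u
    using theI'[OF inverse_ex1[OF that]] by (auto simp: i_def)
  have i_eq: "i u = h" if "u \<in> U" "h \<in> U" "[u * h = 1] (mod f)" for u h
    unfolding i_def by (rule the1_equality[OF inverse_ex1]) (use that in auto)
  have "i u \<in> U - T \<and> i u \<noteq> u \<and> i (i u) = u \<and> [u * i u = 1] (mod f)" if u: "u \<in> U - T" for u
  proof (intro conjI)
    have iu: "i u \<in> U" "[u * i u = 1] (mod f)" using u i by auto
    then show "[u * i u = 1] (mod f)" by simp
    then show "i u \<noteq> u" using u by (auto simp: T_def)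
    show ii: "i (i u) = u" using iu u by (intro i_eq) (auto simp: mult.commute)
    have "i u \<notin> T"
    proof
      assume "i u \<in> T"
      then have "i (i u) = i u" using iu by (intro i_eq) (auto simp: T_def)
      then show False using ii \<open>i u \<noteq> u\<close> by simp
    qed
    then show "i u \<in> U - T" using iu by simp
  qed
  then have "[prod (\<lambda>u. u) (U - T) = 1] (mod f)" using involution_cong_prod[of "U - T" i "\<lambda>u. u" f] by auto
  then show ?thesis by simp
qed

lemma G_square: "[G f S ^ 2 = (- 1) ^ card (H - T)] (mod f)"
proof -
  have HT: "(U - T) \<inter> H = H - T" using H_subset_U by auto
  have "[(- 1) ^ card (H - T) * (\<Prod>(H - T))\<^sup>2 = 1] (mod f)"
    using prod_non_involutions symmetric_split(2)[of "U - T"] by (simp add: HT uminus_U uminus_T)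
  \<comment> \<open>The sign is its own inverse, so multiplying by it moves it to the right-hand
    side.\<close>
  then have "[(- 1) ^ card (H - T) * ((- 1) ^ card (H - T) * (\<Prod>(H - T))\<^sup>2)
      = (- 1) ^ card (H - T) * 1] (mod f)" by (rule cong_mult[OF cong_refl])
  moreover have "(- 1) ^ card (H - T) * ((- 1) ^ card (H - T) * (\<Prod>(H - T))\<^sup>2) = (\<Prod>(H - T))\<^sup>2"
    by (simp flip: mult.assoc power_add)
  ultimately have HmT: "[(\<Prod>(H - T))\<^sup>2 = (- 1) ^ card (H - T)] (mod f)" by simp
  have "[(\<Prod>u\<in>H \<inter> T. u * u) = (\<Prod>u\<in>H \<inter> T. 1)] (mod f)"
    by (rule cong_prod) (auto simp: T_def)
  then have "[(\<Prod>(H \<inter> T))\<^sup>2 = 1] (mod f)" by (simp add: prod.distrib power2_eq_square)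
  then have "[(\<Prod>(H - T))\<^sup>2 * (\<Prod>(H \<inter> T))\<^sup>2 = (- 1) ^ card (H - T) * 1] (mod f)"
    using HmT by (intro cong_mult)
  moreover have "G f S = \<Prod>(H - T) * \<Prod>(H \<inter> T)"
  proof -
    have "\<Prod>((H - T) \<union> (H \<inter> T)) = \<Prod>(H - T) * \<Prod>(H \<inter> T)"
      by (rule prod.union_disjoint) auto
    then show ?thesis by (simp add: G_def H_def[symmetric] Un_Diff_Int)
  qed
  ultimately show ?thesis by (simp add: power_mult_distrib)
qed

section \<open>Moduli with two coprime nonunit factors\<close>

lemma is_unit_two: "is_unit (2 :: 'a poly)"
  using odd_char by (simp add: numeral_poly is_unit_pCons_iff)

lemma one_not_cong_minus_one:
  assumes "\<not> is_unit a"
  shows "\<not> [1 = (- 1 :: 'a poly)] (mod a)"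
  using assms is_unit_two dvd_trans by (auto simp: cong_iff_dvd_diff)

lemma even_card_if_split:
  assumes ab: "f = a * b" "coprime a b" "\<not> is_unit a" "\<not> is_unit b"
  shows "even (card (H - T))"
proof -
  obtain x y where xy: "x * a + y * b = 1" using coprime_poly_bezout ab by blast
  \<comment> \<open>Modulo \<open>a\<close> the Bezout identity reads \<open>y * b = 1\<close>,
    modulo \<open>b\<close> it reads \<open>x * a = 1\<close>; hence \<open>e\<close> is
    \<open>1\<close> modulo \<open>a\<close> and \<open>-1\<close> modulo \<open>b\<close>.\<close>
  define e where "e = y * b - x * a"
  have e1: "e - 1 = a * (- 2 * x)" and e2: "e - - 1 = b * (2 * y)"
    using xy by (simp_all add: e_def algebra_simps flip: xy)
  have "[e = 1] (mod a)" "[e = - 1] (mod b)"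
    unfolding cong_iff_dvd_diff e1 e2 by simp_all
  have e_ne: "\<not> [e = 1] (mod f)" "\<not> [e = - 1] (mod f)"
  proof -
    have "\<not> [e = 1] (mod b)" "\<not> [e = - 1] (mod a)"
      using \<open>[e = 1] (mod a)\<close> \<open>[e = - 1] (mod b)\<close> ab(3,4) one_not_cong_minus_one cong_sym cong_trans
      by blast+
    then show "\<not> [e = 1] (mod f)" "\<not> [e = - 1] (mod f)"
      using ab(1) by (auto simp: cong_iff_dvd_diff dest: dvd_mult_left dvd_mult_right)
  qed
  have "e * e - 1 = (e - 1) * (e - - 1)" by (simp add: algebra_simps)
  also have "\<dots> = f * (- 2 * x * (2 * y))" unfolding e1 e2 ab(1) by (simp add: mult_ac)
  finally have ee: "[e * e = 1] (mod f)" by (simp add: cong_iff_dvd_diff)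
  then have "coprime e f" using coprime_poly_iff_invertible by blast
  define i where "i u = (if e * u mod f \<in> H then e * u mod f else - (e * u mod f))" for u
  have i: "i u \<in> H" "[i u = e * u] (mod f) \<or> [i u = - (e * u)] (mod f)" if "u \<in> H" for u
  proof -
    have "coprime u f" using that by (simp add: H_iff U_iff)
    then have "e * u mod f \<in> U" using coprime_poly_mult_left[OF \<open>coprime e f\<close>] mod_in_U by blast
    then show "i u \<in> H" by (auto simp: i_def uminus_H)
    have "[- (e * u mod f) = - (e * u)] (mod f)"
      by (simp only: cong_minus_minus_iff cong_mod_left cong_refl)
    then show "[i u = e * u] (mod f) \<or> [i u = - (e * u)] (mod f)"
      by (auto simp: i_def)
  qed
  \<comment> \<open>Squares are preserved since \<open>e * e\<close> is congruent to
    \<open>1\<close>; this keeps \<open>i\<close> from mapping \<open>H - T\<close> into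
    \<open>T\<close>.\<close>
  have i_sq: "[i u * i u = u * u] (mod f)" if "u \<in> H" for u
  proof -
    have "[i u * i u = (e * u) * (e * u)] (mod f)"
      using i(2)[OF that] cong_mult[of "i u" "e * u" f "i u" "e * u"]
        cong_mult[of "i u" "- (e * u)" f "i u" "- (e * u)"] by auto
    moreover have "[(e * e) * (u * u) = 1 * (u * u)] (mod f)" using ee by (intro cong_mult) auto
    then have "[(e * u) * (e * u) = u * u] (mod f)" by (simp add: mult_ac)
    ultimately show ?thesis by (rule cong_trans)
  qed
  have "i u \<in> H - T \<and> i u \<noteq> u \<and> i (i u) = u" if u: "u \<in> H - T" for u
  proof (intro conjI)
    have uH: "u \<in> H" using u by simp
    have "i u \<notin> T"
    proof
      assume "i u \<in> T"
      then have "[u * u = 1] (mod f)" using i_sq[OF uH] cong_sym cong_trans unfolding T_def by blast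
      then show False using u H_subset_U by (auto simp: T_def)
    qed
    then show "i u \<in> H - T" using i[OF uH] by simp
    have "coprime u f" using uH by (simp add: H_iff U_iff)
    then obtain h where h: "[u * h = 1] (mod f)" using coprime_poly_iff_invertible by blast
    \<comment> \<open>Cancelling \<open>u\<close> by its inverse \<open>h\<close>, a fixed point
      would make \<open>e\<close> congruent to \<open>1\<close> or \<open>-1\<close> modulo
      \<open>f\<close>.\<close>
    show "i u \<noteq> u"
    proof
      assume eq: "i u = u"
      obtain s where s: "s = 1 \<or> s = - 1" "[u = s * (e * u)] (mod f)"
        using i(2)[OF uH] eq by (metis mult_1 mult_minus1)
      have "[u * h = s * (e * u) * h] (mod f)" using s(2) by (rule cong_mult) simp
      moreover have "[(s * e) * (u * h) = (s * e) * 1] (mod f)" using h by (rule cong_mult[OF cong_refl])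
      then have "[s * (e * u) * h = s * e] (mod f)" by (simp add: mult_ac)
      ultimately have "[1 = s * e] (mod f)" using h cong_sym cong_trans by blast
      then have "[s * e = 1] (mod f)" by (rule cong_sym)
      then show False
        using s(1) e_ne cong_minus_minus_iff[of "- e" 1 f] by auto
    qed
    \<comment> \<open>Multiplying by \<open>e\<close> twice returns \<open>u\<close> up to sign, and
      elements of \<open>H\<close> are determined up to sign.\<close>
    have c: "[e * i u = u] (mod f) \<or> [e * i u = - u] (mod f)"
    proof -
      obtain s where s: "s = 1 \<or> s = - 1" "[i u = s * (e * u)] (mod f)"
        using i(2)[OF uH] by (metis mult_1 mult_minus1)
      have "[e * i u = e * (s * (e * u))] (mod f)" using s(2) by (rule cong_mult[OF cong_refl])
      moreover have "[(e * e) * (s * u) = 1 * (s * u)] (mod f)" using ee by (rule cong_mult) simp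
      then have "[e * (s * (e * u)) = s * u] (mod f)" by (simp add: mult_ac)
      ultimately have "[e * i u = s * u] (mod f)" by (rule cong_trans)
      then show ?thesis using s(1) by auto
    qed
    show "i (i u) = u"
    proof (rule H_eqI)
      have "[- (e * i u) = - u] (mod f) \<or> [- (e * i u) = - (- u)] (mod f)"
        using c by (simp only: cong_minus_minus_iff)
      then show "[i (i u) = u] (mod f) \<or> [i (i u) = - u] (mod f)"
        using c i(2)[OF i(1)[OF uH]] cong_trans by (metis minus_minus)
    qed (use i uH in auto)
  qed
  then show ?thesis by (intro involution_even_card[of _ i]) auto
qed

section \<open>Moduli with a single prime divisor\<close>

lemma prime_power_iff_coprime:
  assumes "prime_divisors f = {P}"
  shows "coprime g f \<longleftrightarrow> \<not> P dvd g"
proof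
  have P: "irreducible P" "P dvd f" using assms by (auto simp: prime_divisors_def)
  show "\<not> P dvd g" if "coprime g f"
    using that P irreducible_not_unit coprime_common_divisor by blast
  assume "\<not> P dvd g"
  then have "coprime P g" using P irreducible_poly_coprime by blast
  moreover obtain k b where "f = P ^ k * b" "is_unit b"
    using single_prime_divisor_power[OF f_nonzero assms] by blast
  moreover from this have "coprime b g" using is_unit_left_imp_coprime by blast
  ultimately have "coprime f g" using coprime_poly_power_left coprime_poly_mult_left by blast
  then show "coprime g f" by (simp add: coprime_commute)
qed

text \<open>\<open>P\<close> cannot divide both \<open>u - 1\<close> and \<open>u + 1\<close>, whose
  difference \<open>2\<close> is a unit. The factor missed by \<open>P\<close> is coprime to
  \<open>f\<close>, so \<open>f\<close> divides the other one. Thus \<open>T\<close> is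
  \<open>{1, - 1}\<close>, and \<open>H\<close> contains exactly one of the two signs.\<close>

lemma card_H_inter_T:
  assumes P: "prime_divisors f = {P}"
  shows "card (H \<inter> T) = 1"
proof -
  have "1 \<in> U" using deg by (simp add: U_iff)
  have "T = {1, - 1}"
  proof (intro equalityI subsetI)
    fix u assume "u \<in> T"
    then have u: "u \<in> U" and dvd: "f dvd (u - 1) * (u + 1)"
      by (auto simp: T_def cong_iff_dvd_diff algebra_simps)
    have "\<not> P dvd u - 1 \<or> \<not> P dvd u + 1"
    proof (rule ccontr)
      assume "\<not> (\<not> P dvd u - 1 \<or> \<not> P dvd u + 1)"
      then have "P dvd (u + 1) - (u - 1)" using dvd_diff by blast
      then have "P dvd 2" by simp
      moreover have "\<not> is_unit P" using P irreducible_not_unit by (auto simp: prime_divisors_def)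
      ultimately show False using is_unit_two dvd_trans by blast
    qed
    then have "f dvd u + 1 \<or> f dvd u - 1"
    proof
      assume "\<not> P dvd u - 1"
      then show ?thesis using prime_power_iff_coprime[OF P] coprime_poly_dvd_mult[OF _ dvd] coprime_commute by blast
    next
      assume "\<not> P dvd u + 1"
      then show ?thesis using prime_power_iff_coprime[OF P] coprime_poly_dvd_mult[of f "u + 1" "u - 1"] dvd
          coprime_commute by (metis mult.commute)
    qed
    then have "[u = - 1] (mod f) \<or> [u = 1] (mod f)" by (simp add: cong_iff_dvd_diff)
    then show "u \<in> {1, - 1}" using U_eqI[OF u] \<open>1 \<in> U\<close> uminus_U[of 1] by blast
  qed (use \<open>1 \<in> U\<close> uminus_U[of 1] in \<open>auto simp: T_def\<close>)
  then have "H \<inter> T = (if 1 \<in> H then {1} else {- 1})" using uminus_H[of 1] \<open>1 \<in> U\<close> by auto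
  then show ?thesis by simp
qed

text \<open>The reduced residues outside \<open>U\<close>, including \<open>0\<close>, are the
  multiples \<open>P * h\<close> with \<open>h = 0\<close> or
  \<open>degree h < degree f - degree P\<close>.\<close>

lemma card_U:
  assumes P: "prime_divisors f = {P}"
  shows "card U + CARD('a) ^ (degree f - degree P) = CARD('a) ^ degree f"
    and "degree P \<le> degree f"
proof -
  let ?R = "\<lambda>n. {g :: 'a poly. g = 0 \<or> degree g < n}"
  have "P \<in> prime_divisors f" using P by simp
  then have "P \<noteq> 0" "P dvd f" by (auto simp: prime_divisors_def)
  then show le: "degree P \<le> degree f" using f_nonzero dvd_imp_degree_le by blast
  have "?R (degree f) = U \<union> (\<lambda>h. P * h) ` ?R (degree f - degree P)"
  proof (intro equalityI subsetI)
    fix g assume g: "g \<in> ?R (degree f)"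
    show "g \<in> U \<union> (\<lambda>h. P * h) ` ?R (degree f - degree P)"
    proof (cases "P dvd g")
      case True
      then obtain h where h: "g = P * h" by blast
      then have "h \<in> ?R (degree f - degree P)"
        using g \<open>P \<noteq> 0\<close> by (cases "h = 0") (auto simp: degree_mult_eq)
      then show ?thesis using h by blast
    next
      case False
      then show ?thesis using g prime_power_iff_coprime[OF P] by (auto simp: U_iff)
    qed
  next
    fix g assume "g \<in> U \<union> (\<lambda>h. P * h) ` ?R (degree f - degree P)"
    then show "g \<in> ?R (degree f)"
    proof
      assume "g \<in> (\<lambda>h. P * h) ` ?R (degree f - degree P)"
      then obtain h where "g = P * h" "h = 0 \<or> degree h < degree f - degree P" by blast
      then show ?thesis using \<open>P \<noteq> 0\<close> by (cases "h = 0") (auto simp: degree_mult_eq)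
    qed (simp add: U_iff)
  qed
  moreover have "U \<inter> (\<lambda>h. P * h) ` ?R (degree f - degree P) = {}"
    using prime_power_iff_coprime[OF P] U_iff dvd_triv_left by blast
  \<comment> \<open>Finiteness is read off from the cardinality being positive.\<close>
  moreover have "finite (?R (degree f - degree P))"
    by (rule card_ge_0_finite) (simp only: card_polys_degree_less, simp)
  ultimately have "card (?R (degree f)) = card U + card ((\<lambda>h. P * h) ` ?R (degree f - degree P))"
    by (simp only: card_Un_disjoint finite_U finite_imageI)
  also have "card ((\<lambda>h. P * h) ` ?R (degree f - degree P)) = card (?R (degree f - degree P))"
    using \<open>P \<noteq> 0\<close> by (intro card_image inj_onI) simp
  finally show "card U + CARD('a) ^ (degree f - degree P) = CARD('a) ^ degree f"
    by (simp add: card_polys_degree_less)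
qed

text \<open>From \<open>2 * card H = m * (Q - 1)\<close> with \<open>m\<close> odd,
  \<open>card H\<close> is even exactly when \<open>Q\<close> is \<open>1\<close> modulo
  \<open>4\<close>. Removing the single element of \<open>H \<inter> T\<close> flips the
  parity.\<close>

lemma parity_if_prime_power:
  assumes P: "prime_divisors f = {P}" and q: "odd (CARD('a))"
  shows "even (card (H - T)) \<longleftrightarrow> \<not> ([CARD('a) = 1] (mod 4) \<or> even (degree P))"
proof -
  let ?q = "CARD('a)"
  define m where "m = ?q ^ (degree f - degree P)"
  define Q where "Q = ?q ^ degree P"
  have "card U = 2 * card H" using symmetric_split(1)[of U] H_subset_U by (simp add: uminus_U Int_absorb1)
  moreover have "?q ^ degree f = m * Q"
    using card_U(2)[OF P] by (simp add: m_def Q_def flip: power_add)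
  ultimately have eq: "2 * card H + m = m * Q" using card_U(1)[OF P] by (simp add: m_def)
  have m: "odd m" using q by (simp add: m_def)
  have "?q mod 4 = 1 \<or> ?q mod 4 = 3" using q by presburger
  then have Q: "Q mod 4 = (if [?q = 1] (mod 4) \<or> even (degree P) then 1 else 3)"
  proof
    assume "?q mod 4 = 3"
    \<comment> \<open>Powers of \<open>3\<close> alternate between \<open>1\<close> and
      \<open>3\<close> modulo \<open>4\<close>.\<close>
    then have "[?q ^ n = (if even n then 1 else 3)] (mod 4)" for n
      by (induction n) (auto simp: cong_def mod_mult_eq[symmetric, of ?q _ 4])
    then show ?thesis using \<open>?q mod 4 = 3\<close> by (auto simp: cong_def Q_def split: if_splits)
  next
    assume "?q mod 4 = 1"
    then have "[?q ^ degree P = 1 ^ degree P] (mod 4)" by (intro cong_pow) (simp add: cong_def)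
    then show ?thesis using \<open>?q mod 4 = 1\<close> by (simp add: cong_def Q_def)
  qed
  have "even (card H) \<longleftrightarrow> Q mod 4 = 1"
  proof -
    obtain j r where jr: "Q = 4 * j + r" "r = 1 \<or> r = 3"
      using Q by (metis mult_div_mod_eq)
    then show ?thesis
    proof (elim disjE)
      assume "r = 1"
      then have "card H = 2 * (m * j)" using eq jr by (simp add: algebra_simps)
      then show ?thesis using jr \<open>r = 1\<close> by simp
    next
      assume "r = 3"
      then have "card H = m * (2 * j + 1)" using eq jr by (simp add: algebra_simps)
      then show ?thesis using jr \<open>r = 3\<close> m by simp
    qed
  qed
  moreover have "card H = card (H - T) + 1"
    using card_H_inter_T[OF P] card_Int_Diff[of H T] by simp
  ultimately show ?thesis using Q by auto
qed

lemma not_single_prime_imp_even: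
  assumes "\<nexists>P. prime_divisors f = {P}"
  shows "even (card (H - T))"
proof -
  obtain P where "P \<in> prime_divisors f"
    using prime_divisors_nonempty f_nonzero f_nonunit by blast
  then obtain Q where "Q \<in> prime_divisors f" "P \<noteq> Q" using assms by blast
  then show ?thesis
    using two_prime_divisors_split[OF f_nonzero \<open>P \<in> prime_divisors f\<close>] even_card_if_split by blast
qed

end

section \<open>The order of the half product\<close>

lemma poly_ord_square_one:
  fixes f g :: "'a::field poly"
  assumes "[g ^ 2 = 1] (mod f)"
  shows "poly_ord f g \<in> {1, 2}"
proof -
  let ?l = "LEAST d. d > 0 \<and> [g ^ d = 1] (mod f)"
  have 2: "(2::nat) > 0 \<and> [g ^ 2 = 1] (mod f)" using assms by simp
  then have "\<exists>d>0. [g ^ d = 1] (mod f)" by blast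
  then have "poly_ord f g = ?l" unfolding poly_ord_def by (rule if_P)
  moreover have "?l > 0 \<and> [g ^ ?l = 1] (mod f)" using 2 by (rule LeastI)
  moreover have "?l \<le> 2" using 2 by (rule Least_le)
  ultimately show ?thesis by auto
qed

lemma poly_ord_square_minus_one:
  fixes f g :: "'a::field poly"
  assumes g: "[g ^ 2 = - 1] (mod f)" and ne: "\<not> [1 = - 1] (mod f)"
  shows "poly_ord f g = 4"
proof -
  have "[g ^ 2 * g ^ 2 = - 1 * - 1] (mod f)" using g by (intro cong_mult)
  then have 4: "[g ^ 4 = 1] (mod f)" by (simp flip: power_add)
  have n2: "\<not> [g ^ 2 = 1] (mod f)" using g ne cong_sym cong_trans by blast
  have n1: "\<not> [g = 1] (mod f)" using n2 cong_pow[of g 1 f 2] by auto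
  have n3: "\<not> [g ^ 3 = 1] (mod f)"
  proof
    assume "[g ^ 3 = 1] (mod f)"
    \<comment> \<open>If both the third and the fourth power were \<open>1\<close>, so would be
      \<open>g\<close>.\<close>
    then have "[g ^ 3 * g = 1 * g] (mod f)" by (rule cong_mult) simp
    then have "[g ^ 4 = g] (mod f)" by (simp add: eval_nat_numeral mult_ac)
    then show False using 4 n1 cong_sym cong_trans by blast
  qed
  have "(LEAST d. d > 0 \<and> [g ^ d = 1] (mod f)) = 4"
  proof (rule Least_equality)
    fix d assume d: "d > 0 \<and> [g ^ d = 1] (mod f)"
    show "4 \<le> d"
    proof (rule ccontr)
      assume "\<not> 4 \<le> d"
      then have "d = 1 \<or> d = 2 \<or> d = 3" using d by linarith
      then show False using d n1 n2 n3 by auto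
    qed
  qed (use 4 in simp)
  then show ?thesis using 4 unfolding poly_ord_def by (auto intro!: exI[of _ 4])
qed

text \<open>\<open>S\<close> and its negatives are disjoint and together have as many elements as
  there are nonzero constants, so they exhaust them.\<close>

lemma half_set_iff:
  fixes S :: "'a::{field,finite} set"
  assumes "S \<subseteq> UNIV - {0}" "card S = (CARD('a) - 1) div 2" "odd (CARD('a))"
    and neg: "\<And>\<alpha>. \<alpha> \<in> S \<Longrightarrow> - \<alpha> \<notin> S"
  shows "\<alpha> \<in> S \<longleftrightarrow> \<alpha> \<noteq> 0 \<and> - \<alpha> \<notin> S"
proof -
  have "card (S \<union> uminus ` S) = card S + card (uminus ` S)"
    using neg by (intro card_Un_disjoint) auto
  also have "\<dots> = 2 * card S" by (simp add: card_image inj_on_def)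
  also have "\<dots> = card (UNIV - {0 :: 'a})" using assms(2,3) by simp
  finally have "S \<union> uminus ` S = UNIV - {0}"
    using assms(1) by (intro card_subset_eq) auto
  then have "\<alpha> \<noteq> 0 \<Longrightarrow> \<alpha> \<in> S \<or> - \<alpha> \<in> S" by (auto simp: set_eq_iff)
  then show ?thesis using assms(1) neg by blast
qed

text \<open>If \<open>2\<close> were \<open>0\<close>, adding \<open>1\<close> would be a
  fixed-point-free involution of the field.\<close>

lemma odd_card_two_nonzero:
  assumes "odd (CARD('a::{field,finite}))"
  shows "(2 :: 'a) \<noteq> 0"
proof
  assume "(2 :: 'a) = 0"
  then have "x + 1 + 1 = x" for x :: 'a by (simp add: add.assoc)
  then have "even (card (UNIV :: 'a set))"
    by (intro involution_even_card[of _ "\<lambda>x. x + 1"]) auto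
  then show False using assms by simp
qed

theorem theorem4p2:
  fixes f :: "'a::{field,finite} poly" and S :: "'a set" and q :: nat
  assumes "q = CARD('a)"
    and "odd q"
    and "degree f \<ge> 1"
    and "S \<subseteq> UNIV - {0}"
    and "card S = (q - 1) div 2"
    and "\<And>\<alpha>. \<alpha> \<in> S \<Longrightarrow> - \<alpha> \<notin> S"
  shows "if \<exists>P. prime_divisors f = {P} \<and> ([q = 1] (mod 4) \<or> even (degree P))
         then poly_ord f (G f S) = 4
         else poly_ord f (G f S) \<in> {1, 2}"
proof -
  interpret half_system f S
  proof
    show "(2 :: 'a) \<noteq> 0" using odd_card_two_nonzero assms(1,2) by simp
    show "\<alpha> \<in> S \<longleftrightarrow> \<alpha> \<noteq> 0 \<and> - \<alpha> \<notin> S" for \<alpha>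
      using assms by (intro half_set_iff) simp_all
  qed fact
  show ?thesis
  proof (cases "\<exists>P. prime_divisors f = {P} \<and> ([q = 1] (mod 4) \<or> even (degree P))")
    case True
    then have "odd (card (H - T))" using parity_if_prime_power assms(1,2) by blast
    then have "[G f S ^ 2 = - 1] (mod f)" using G_square by simp
    then have "poly_ord f (G f S) = 4"
      using one_not_cong_minus_one[OF f_nonunit] by (rule poly_ord_square_minus_one)
    then show ?thesis using True by simp
  next
    case False
    \<comment> \<open>Either \<open>f\<close> has a single prime divisor and the parity count
      applies, or it has at least two and splits into coprime nonunits.\<close>
    have "even (card (H - T))"
    proof (cases "\<exists>P. prime_divisors f = {P}")
      case True
      then show ?thesis using False parity_if_prime_power assms(1,2) by blast
    qed (rule not_single_prime_imp_even)
    then have "[G f S ^ 2 = 1] (mod f)" using G_square by simp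
    then have "poly_ord f (G f S) \<in> {1, 2}" by (rule poly_ord_square_one)
    then show ?thesis by (simp only: if_not_P[OF False])
  qed
qed

end
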